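(* Let $X$ be a hereditary class of graphs and $d$ a constant. If every graph in $X$ has a vertex of degree or co-degree at most $d$, then $X$ admits an implicit representation.
   Context: Graphs are finite, simple and undirected, with nonempty vertex set; classes of graphs are closed under isomorphism. A class is hereditary if it is closed under taking induced subgraphs. The co-degree of a vertex is the number of its non-neighbours, i.e. its degree in the complement of the graph. A class $X$ of graphs admits an implicit representation if the vertices of every $n$-vertex graph $G\in X$ can be assigned binary codes of length $O(\log n)$ (with constant depending only on $X$) so that the adjacency of any two vertices is a function of their two codes, the function depending only on $X$. *)

theory Defs
  imports "Graph_Theory.Graph_Theory" "HOL-Library.Landau_Symbols"
begin

text \<open>
  A finite simple undirected graph is a \<open>pair_graph\<close>, whose edge set is a symmetric irreflexive
  relation. Vertices are natural numbers: every finite graph has an isomorphic copy there, so a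
  class of finite graphs closed under isomorphism is determined by its members with vertices in
  \<open>nat\<close>.
\<close>

definition graph_class :: "nat pair_pre_digraph set \<Rightarrow> bool" where
  "graph_class X \<longleftrightarrow>
     (\<forall>G\<in>X. pair_graph G \<and> pverts G \<noteq> {}) \<and>
     (\<forall>G\<in>X. \<forall>H :: nat pair_pre_digraph. digraph_iso (with_proj G) (with_proj H) \<longrightarrow> H \<in> X)"

definition hereditary :: "nat pair_pre_digraph set \<Rightarrow> bool" where
  "hereditary X \<longleftrightarrow>
     (\<forall>G\<in>X. \<forall>H :: nat pair_pre_digraph.
        induced_subgraph (with_proj H) (with_proj G) \<and> pverts H \<noteq> {} \<longrightarrow> H \<in> X)"

definition complement :: "'a pair_pre_digraph \<Rightarrow> 'a pair_pre_digraph" where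
  "complement G = \<lparr> pverts = pverts G,
     parcs = {(u, v). u \<in> pverts G \<and> v \<in> pverts G \<and> u \<noteq> v \<and> (u, v) \<notin> parcs G} \<rparr>"

text \<open>An edge is stored as two opposite arcs, so the degree of a vertex is its out-degree.\<close>

definition degree :: "'a pair_pre_digraph \<Rightarrow> 'a \<Rightarrow> nat" where
  "degree G v = out_degree (with_proj G) v"

definition codegree :: "'a pair_pre_digraph \<Rightarrow> 'a \<Rightarrow> nat" where
  "codegree G v = degree (complement G) v"

lemma degree_eq_card_neighbours:
  assumes "pair_graph G"
  shows "degree G v = card {u \<in> pverts G. (v, u) \<in> parcs G}"
proof -
  interpret pair_graph G by (fact assms)
  have "out_arcs (with_proj G) v = Pair v ` {u \<in> pverts G. (v, u) \<in> parcs G}"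
    by (auto simp: out_arcs_def intro: in_arcsD2)
  then show ?thesis
    by (simp add: degree_def out_degree_def card_image inj_on_def)
qed

lemma codegree_eq_card_nonneighbours:
  assumes "v \<in> pverts G"
  shows "codegree G v = card {u \<in> pverts G. u \<noteq> v \<and> (v, u) \<notin> parcs G}"
proof -
  have "out_arcs (with_proj (complement G)) v =
      Pair v ` {u \<in> pverts G. u \<noteq> v \<and> (v, u) \<notin> parcs G}"
    using assms by (auto simp: out_arcs_def complement_def)
  then show ?thesis
    by (simp add: codegree_def degree_def out_degree_def card_image inj_on_def)
qed

text \<open>
  The decoder \<open>dec\<close> and the bound \<open>len\<close> on the code length are chosen before the graph, hence
  depend on the class only. The decoder also answers correctly (negatively) when applied to
  twice the same vertex.
\<close>

definition admits_implicit_representation :: "nat pair_pre_digraph set \<Rightarrow> bool" where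
  "admits_implicit_representation X \<longleftrightarrow>
     (\<exists>(len :: nat \<Rightarrow> nat) (dec :: bool list \<Rightarrow> bool list \<Rightarrow> bool).
        (\<lambda>n. real (len n)) \<in> O(\<lambda>n. ln (real n)) \<and>
        (\<forall>G\<in>X. \<exists>code :: nat \<Rightarrow> bool list.
           (\<forall>v\<in>pverts G. length (code v) \<le> len (card (pverts G))) \<and>
           (\<forall>u\<in>pverts G. \<forall>v\<in>pverts G. (u, v) \<in> parcs G \<longleftrightarrow> dec (code u) (code v))))"

end

theory Submission
  imports Defs "HOL-Library.Log_Nat"
begin

text \<open>
  By heredity every nonempty induced subgraph of a graph \<open>G\<close> in the class has a vertex of small
  degree or co-degree, so the vertices of \<open>G\<close> can be peeled off one at a time, always removing such
  a vertex from what is left. Number them so that the vertex removed first gets the largest number.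
  Every vertex \<open>v\<close> is then either adjacent to at most \<open>d\<close> of the vertices below it, or non-adjacent
  to at most \<open>d\<close> of them. Let its label be the number of \<open>v\<close>, one bit saying which of
  the two cases holds, and the numbers of these at most \<open>d\<close> exceptional vertices. Adjacency of two
  vertices can be read off their labels: the exceptions of the vertex with the larger number, together
  with its bit, settle the question (\<open>ordered_labelling\<close>).

  An \<open>n\<close>-vertex graph uses at most \<open>2 * n ^ (d + 1)\<close> different labels, and polynomially many
  labels fit into binary words of logarithmic length (\<open>admits_implicit_representationI\<close>).
\<close>

section \<open>Polynomially many labels suffice\<close>

text \<open>
  This separates the combinatorics from the binary encoding: there are \<open>2 ^ L\<close> words of length \<open>L\<close>,
  so counting gives an injection of the labels into words.
  The decoder does not know the number \<open>n\<close> of vertices. Therefore the injection is chosen for each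
  bit length \<open>k\<close> of \<open>n\<close> instead of for each \<open>n\<close>, which monotonicity of \<open>D\<close> permits, and
  \<open>k\<close> is recovered from the length of the code, for which \<open>c\<close> has to be positive.
\<close>

lemma admits_implicit_representationI:
  fixes D :: "nat \<Rightarrow> 'l set" and adj :: "'l \<Rightarrow> 'l \<Rightarrow> bool"
  assumes "mono D" and fin: "\<And>n. finite (D n)"
    and card_D: "\<And>n. card (D n) \<le> K * n ^ c" and "c > 0"
    and nonempty: "\<And>G. G \<in> X \<Longrightarrow> card (pverts G) > 0"
    and label: "\<And>G. G \<in> X \<Longrightarrow> \<exists>lab. lab ` pverts G \<subseteq> D (card (pverts G)) \<and>
      (\<forall>u\<in>pverts G. \<forall>v\<in>pverts G. (u, v) \<in> parcs G \<longleftrightarrow> adj (lab u) (lab v))"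
  shows "admits_implicit_representation X"
proof -
  define words :: "nat \<Rightarrow> bool list set" where "words L = {w. length w = L}" for L
  have words: "finite (words L)" "card (words L) = 2 ^ L" for L
    using finite_lists_length_eq[of "UNIV :: bool set" L] card_lists_length_eq[of "UNIV :: bool set" L]
    by (simp_all add: words_def)
  have "\<exists>e. e ` D (2 ^ k) \<subseteq> words (K + c * k) \<and> inj_on e (D (2 ^ k))" for k
  proof (rule card_le_inj[OF fin words(1)])
    have "card (D (2 ^ k)) \<le> K * 2 ^ (c * k)"
      using card_D[of "2 ^ k"] by (simp add: power_mult [symmetric] mult.commute)
    also have "\<dots> \<le> 2 ^ K * 2 ^ (c * k)"
      by (intro mult_right_mono) (simp_all add: less_imp_le)
    finally show "card (D (2 ^ k)) \<le> card (words (K + c * k))"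
      by (simp add: words power_add)
  qed
  then obtain e where e_words: "\<And>k. e k ` D (2 ^ k) \<subseteq> words (K + c * k)"
    and e_inj: "\<And>k. inj_on (e k) (D (2 ^ k))"
    by metis
  define len where "len n = K + c * floorlog 2 n" for n
  define decode where
    "decode w = (let k = (length w - K) div c in inv_into (D (2 ^ k)) (e k) w)" for w
  have decode: "decode (e k x) = x" if "x \<in> D (2 ^ k)" for k x
  proof -
    have "length (e k x) = K + c * k"
      using e_words[of k] that by (auto simp: words_def)
    then show ?thesis
      using \<open>c > 0\<close> that e_inj by (simp add: decode_def inv_into_f_f)
  qed
  have "(\<lambda>n. real (len n)) \<in> O(\<lambda>n. ln (real n))"
  proof (rule bigoI)
    show "\<forall>\<^sub>F n in sequentially.
      norm (real (len n)) \<le> (real K + real c * (1 / ln 2 + 1)) * norm (ln (real n))"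
      using eventually_ge_at_top[of "3 :: nat"]
    proof eventually_elim
      case (elim n)
      \<comment> \<open>Since \<open>e \<le> 3\<close>, the logarithm is at least 1 and absorbs the additive constants.\<close>
      have "exp 1 \<le> real n"
        using exp_le elim by linarith
      then have ln_ge_1: "1 \<le> ln (real n)"
        using elim by (simp add: ln_ge_iff)
      have "real (floorlog 2 n) \<le> log 2 n + 1"
        using elim by (simp add: floorlog_def)
      also have "\<dots> \<le> (1 / ln 2 + 1) * ln (real n)"
        using ln_ge_1 by (simp add: log_def algebra_simps)
      finally have "real c * floorlog 2 n \<le> real c * ((1 / ln 2 + 1) * ln (real n))"
        by (rule mult_left_mono) simp
      moreover have "real K \<le> real K * ln (real n)"
        using ln_ge_1 by (simp add: mult_le_cancel_left1)
      ultimately show ?case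
        using ln_ge_1 by (simp add: len_def algebra_simps)
    qed
  qed
  moreover have "\<exists>code. (\<forall>v\<in>pverts G. length (code v) \<le> len (card (pverts G))) \<and>
      (\<forall>u\<in>pverts G. \<forall>v\<in>pverts G. (u, v) \<in> parcs G \<longleftrightarrow> adj (decode (code u)) (decode (code v)))"
    if "G \<in> X" for G
  proof -
    define n where "n = card (pverts G)"
    define k where "k = floorlog 2 n"
    obtain lab where lab: "lab ` pverts G \<subseteq> D n"
        "\<forall>u\<in>pverts G. \<forall>v\<in>pverts G. (u, v) \<in> parcs G \<longleftrightarrow> adj (lab u) (lab v)"
      using label[OF \<open>G \<in> X\<close>] by (auto simp: n_def)
    have "n \<le> 2 ^ k"
      using nonempty[OF that] floorlog_bounds[of n 2] by (simp add: n_def k_def)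
    then have lab_D: "lab v \<in> D (2 ^ k)" if "v \<in> pverts G" for v
      using lab(1) that monoD[OF \<open>mono D\<close>] by blast
    then have "length (e k (lab v)) = len n" if "v \<in> pverts G" for v
      using e_words[of k] that by (auto simp: words_def len_def k_def)
    then show ?thesis
      using lab(2) by (intro exI[of _ "\<lambda>v. e k (lab v)"]) (simp add: decode lab_D n_def)
  qed
  ultimately show ?thesis
    unfolding admits_implicit_representation_def
    by (intro exI[of _ len] exI[of _ "\<lambda>w w'. adj (decode w) (decode w')"]) blast
qed

section \<open>Labels from a peeling order\<close>

text \<open>
  The numbering grows from the end: the vertex found in the whole set gets the largest number, so
  that it is compared with all of \<open>V\<close>, and the others are numbered recursively.
\<close>

lemma ex_peeling_order:
  fixes P :: "'v set \<Rightarrow> 'v \<Rightarrow> bool"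
  assumes "finite V" and "\<And>W. W \<subseteq> V \<Longrightarrow> W \<noteq> {} \<Longrightarrow> \<exists>v\<in>W. P W v"
  shows "\<exists>f :: 'v \<Rightarrow> nat. inj_on f V \<and> f ` V \<subseteq> {..<card V} \<and> (\<forall>v\<in>V. P {u \<in> V. f u \<le> f v} v)"
  using assms
proof (induction V rule: finite_psubset_induct)
  case (psubset V)
  show ?case
  proof (cases "V = {}")
    case False
    then obtain v where v: "v \<in> V" "P V v"
      using psubset.prems[of V] by auto
    have "\<exists>f :: 'v \<Rightarrow> nat. inj_on f (V - {v}) \<and> f ` (V - {v}) \<subseteq> {..<card (V - {v})} \<and>
        (\<forall>w\<in>V - {v}. P {u \<in> V - {v}. f u \<le> f w} w)"
    proof (rule psubset.IH)
      show "V - {v} \<subset> V"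
        using v(1) by blast
      show "\<exists>w\<in>W. P W w" if "W \<subseteq> V - {v}" "W \<noteq> {}" for W
        using psubset.prems[of W] that by blast
    qed
    then obtain f :: "'v \<Rightarrow> nat" where f: "inj_on f (V - {v})" "f ` (V - {v}) \<subseteq> {..<card (V - {v})}"
        "\<forall>w\<in>V - {v}. P {u \<in> V - {v}. f u \<le> f w} w"
      by auto
    define m where "m = card (V - {v})"
    have card_V: "card V = Suc m"
      unfolding m_def using v(1) psubset.hyps by (metis card_Suc_Diff1)
    have f_less: "f u < m" if "u \<in> V" "u \<noteq> v" for u
      using f(2) that by (auto simp: m_def)
    define g where "g = f(v := m)"
    have "inj_on g V"
      using f(1) f_less by (fastforce simp: g_def inj_on_def)
    moreover have "g ` V \<subseteq> {..<card V}"
      using f_less by (auto simp: g_def card_V intro: less_SucI)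
    moreover have "P {u \<in> V. g u \<le> g w} w" if "w \<in> V" for w
    proof (cases "w = v")
      case True
      have "{u \<in> V. g u \<le> g v} = V"
        using f_less by (force simp: g_def)
      then show ?thesis
        using v(2) True by simp
    next
      case False
      have "{u \<in> V. g u \<le> g w} = {u \<in> V - {v}. f u \<le> f w}"
        using f_less[OF that False] False by (auto simp: g_def)
      then show ?thesis
        using f(3) that False by simp
    qed
    ultimately show ?thesis
      by blast
  qed simp
qed

text \<open>
  A label is a bit and a list. The head of the list is the number of the vertex and the whole list
  holds the numbers of its exceptions; the bit tells whether the exceptions are the neighbours or
  the non-neighbours among the vertices with smaller numbers. The vertex itself may occur among its
  exceptions, because only vertices with different numbers are looked up.
\<close>

fun label_adj :: "bool \<times> nat list \<Rightarrow> bool \<times> nat list \<Rightarrow> bool" where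
  "label_adj (b, xs) (c, ys) =
     (if hd ys < hd xs then hd ys \<in> set xs \<longleftrightarrow> b
      else if hd xs < hd ys then hd xs \<in> set ys \<longleftrightarrow> c
      else False)"

text \<open>
  All lists have length \<open>d + 1\<close>, which makes the labels easy to count.
\<close>

definition labels :: "nat \<Rightarrow> nat \<Rightarrow> (bool \<times> nat list) set" where
  "labels d n = UNIV \<times> {xs. set xs \<subseteq> {..<n} \<and> length xs = d + 1}"

lemma finite_labels: "finite (labels d n)"
  unfolding labels_def by (intro finite_cartesian_product finite_lists_length_eq) auto

lemma card_labels: "card (labels d n) = 2 * n ^ (d + 1)"
  unfolding labels_def card_cartesian_product by (subst card_lists_length_eq) auto

lemma mono_labels: "mono (labels d)"
  by (intro monoI) (auto simp: labels_def)

text \<open>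
  The list is padded to its prescribed length by repeating the head, so that the padding changes
  neither the number of the vertex nor the set of entries.
\<close>

lemma ex_exception_list:
  assumes "finite S" "card S \<le> d"
  shows "\<exists>xs. length xs = d + 1 \<and> hd xs = a \<and> set xs = insert a S"
proof -
  obtain ys where "set ys = S" "length ys = card S"
    using finite_distinct_list[OF assms(1)] distinct_card by metis
  then show ?thesis
    using assms(2) by (intro exI[of _ "a # ys @ replicate (d - card S) a"]) auto
qed

text \<open>
  The bit of \<open>v\<close> records which of the two alternatives in the last assumption holds for \<open>v\<close>.
  Injectivity of \<open>f\<close> makes looking up a number in an exception list the same as looking up the vertex.
\<close>

lemma ordered_labelling:
  fixes f :: "'v \<Rightarrow> nat"
  assumes "finite V" and inj: "inj_on f V" and range: "f ` V \<subseteq> {..<n}"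
    and sym: "\<And>u v. E u v \<Longrightarrow> E v u" and irrefl: "\<And>v. \<not> E v v"
    and few: "\<forall>v\<in>V. card {u \<in> V. f u < f v \<and> E v u} \<le> d \<or>
      card {u \<in> V. f u < f v \<and> \<not> E v u} \<le> d"
  shows "\<exists>lab. lab ` V \<subseteq> labels d n \<and> (\<forall>u\<in>V. \<forall>v\<in>V. E u v \<longleftrightarrow> label_adj (lab u) (lab v))"
proof -
  define exceptions where
    "exceptions v b = f ` {u \<in> V. f u < f v \<and> (E v u \<longleftrightarrow> b)}" for v b
  have "\<exists>l. length (snd l) = d + 1 \<and> hd (snd l) = f v \<and>
      set (snd l) = insert (f v) (exceptions v (fst l))" if "v \<in> V" for v
  proof -
    have finite: "finite (exceptions v b)" for b
      using \<open>finite V\<close> by (simp add: exceptions_def)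
    have le_few: "card (exceptions v b) \<le> card {u \<in> V. f u < f v \<and> (E v u \<longleftrightarrow> b)}" for b
      unfolding exceptions_def using \<open>finite V\<close> by (intro card_image_le) simp
    have "card {u \<in> V. f u < f v \<and> (E v u \<longleftrightarrow> True)} \<le> d \<or>
        card {u \<in> V. f u < f v \<and> (E v u \<longleftrightarrow> False)} \<le> d"
      using few \<open>v \<in> V\<close> by simp
    then obtain b where "card (exceptions v b) \<le> d"
      using le_few[THEN order_trans] by blast
    then obtain xs where "length xs = d + 1" "hd xs = f v"
        "set xs = insert (f v) (exceptions v b)"
      using ex_exception_list[of "exceptions v b" d "f v"] finite by auto
    then show ?thesis
      by (intro exI[of _ "(b, xs)"]) simp
  qed
  then obtain lab where lab: "\<forall>v\<in>V. length (snd (lab v)) = d + 1 \<and> hd (snd (lab v)) = f v \<and>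
      set (snd (lab v)) = insert (f v) (exceptions v (fst (lab v)))"
    using bchoice[of V "\<lambda>v l. length (snd l) = d + 1 \<and> hd (snd l) = f v \<and>
      set (snd l) = insert (f v) (exceptions v (fst l))"] by auto
  define b xs where "b v = fst (lab v)" and "xs v = snd (lab v)" for v
  have lab_eq: "lab v = (b v, xs v)" for v
    by (simp add: b_def xs_def)
  have len: "length (xs v) = d + 1" and hd: "hd (xs v) = f v"
    and set: "set (xs v) = insert (f v) (exceptions v (b v))" if "v \<in> V" for v
    using lab that by (simp_all add: b_def xs_def)
  have "lab ` V \<subseteq> labels d n"
    using range by (auto simp: lab_eq labels_def len set exceptions_def image_subset_iff)
  moreover have "E u v \<longleftrightarrow> label_adj (lab u) (lab v)" if uv: "u \<in> V" "v \<in> V" for u v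
  proof -
    have lookup: "(f w \<in> set (xs v) \<longleftrightarrow> b v) \<longleftrightarrow> E v w"
      if "w \<in> V" "v \<in> V" "f w < f v" for v w
    proof -
      have "f w \<in> set (xs v) \<longleftrightarrow> (E v w \<longleftrightarrow> b v)"
        using that inj by (auto simp: set exceptions_def dest: inj_onD)
      then show ?thesis
        by blast
    qed
    consider "f v < f u" | "f u < f v" | "u = v"
      using inj uv by (metis inj_onD linorder_neqE_nat)
    then show ?thesis
    proof cases
      case 1
      then show ?thesis using uv lookup[of v u] by (simp add: lab_eq hd)
    next
      case 2
      then show ?thesis using uv lookup[of u v] sym by (auto simp: lab_eq hd)
    next
      case 3
      then show ?thesis using irrefl by (simp add: lab_eq)
    qed
  qed
  ultimately show ?thesis
    by blast
qed

section \<open>Hereditary classes with a vertex of bounded degree or co-degree\<close>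

text \<open>
  Heredity turns the hypothesis about whole graphs into one about all vertex subsets of a single
  graph, which is what the peeling order needs.
\<close>

lemma ex_few_neighbours_or_nonneighbours:
  assumes "graph_class X" "hereditary X"
    and "\<forall>G\<in>X. \<exists>v\<in>pverts G. degree G v \<le> d \<or> codegree G v \<le> d"
    and "G \<in> X" and W: "W \<subseteq> pverts G" "W \<noteq> {}"
  shows "\<exists>v\<in>W. card {u \<in> W. (v, u) \<in> parcs G} \<le> d \<or>
    card {u \<in> W. u \<noteq> v \<and> (v, u) \<notin> parcs G} \<le> d"
proof -
  interpret pair_graph G
    using assms(1,4) by (simp add: graph_class_def)
  define H where "H = \<lparr>pverts = W, parcs = {e \<in> parcs G. fst e \<in> W \<and> snd e \<in> W}\<rparr>"
  have "wf_digraph (with_proj H)"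
    by unfold_locales (auto simp: H_def)
  moreover have "wf_digraph (with_proj G)"
    by unfold_locales
  ultimately have "induced_subgraph (with_proj H) (with_proj G)"
    using W(1) by (auto simp: induced_subgraph_def subgraph_def compatible_def H_def)
  then have "H \<in> X"
    using assms(2,4) W(2) by (simp add: hereditary_def H_def)
  then have "pair_graph H"
    using assms(1) by (simp add: graph_class_def)
  obtain v where v: "v \<in> W" "degree H v \<le> d \<or> codegree H v \<le> d"
    using assms(3) \<open>H \<in> X\<close> by (auto simp: H_def)
  have "degree H v = card {u \<in> W. (v, u) \<in> parcs G}"
    unfolding degree_eq_card_neighbours[OF \<open>pair_graph H\<close>]
    using v(1) by (intro arg_cong[where f = card]) (auto simp: H_def)
  moreover have "codegree H v = card {u \<in> W. u \<noteq> v \<and> (v, u) \<notin> parcs G}"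
    using v(1) by (subst codegree_eq_card_nonneighbours)
      (auto simp: H_def intro!: arg_cong[where f = card])
  ultimately show ?thesis
    using v by auto
qed

theorem lemma2:
  fixes X :: "nat pair_pre_digraph set" and d :: nat
  assumes "graph_class X"
    and "hereditary X"
    and "\<forall>G\<in>X. \<exists>v\<in>pverts G. degree G v \<le> d \<or> codegree G v \<le> d"
  shows "admits_implicit_representation X"
proof (rule admits_implicit_representationI)
  show "mono (labels d)"
    by (rule mono_labels)
  show "finite (labels d n)" for n
    by (rule finite_labels)
  show "card (labels d n) \<le> 2 * n ^ (d + 1)" for n
    by (simp add: card_labels)
  fix G assume "G \<in> X"
  then interpret pair_graph G
    using assms(1) by (simp add: graph_class_def)
  show "card (pverts G) > 0"
    using assms(1) \<open>G \<in> X\<close> pair_finite_verts by (auto simp: graph_class_def card_gt_0_iff)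
  define E where "E u v \<longleftrightarrow> (u, v) \<in> parcs G" for u v
  define few where "few W v \<longleftrightarrow>
    card {u \<in> W. E v u} \<le> d \<or> card {u \<in> W. u \<noteq> v \<and> \<not> E v u} \<le> d" for W v
  have "\<exists>f :: nat \<Rightarrow> nat. inj_on f (pverts G) \<and> f ` pverts G \<subseteq> {..<card (pverts G)} \<and>
      (\<forall>v\<in>pverts G. few {u \<in> pverts G. f u \<le> f v} v)"
    using ex_few_neighbours_or_nonneighbours[OF assms \<open>G \<in> X\<close>]
    by (intro ex_peeling_order pair_finite_verts) (simp add: few_def E_def)
  then obtain f :: "nat \<Rightarrow> nat" where f: "inj_on f (pverts G)"
      "f ` pverts G \<subseteq> {..<card (pverts G)}"
      "\<And>v. v \<in> pverts G \<Longrightarrow> few {u \<in> pverts G. f u \<le> f v} v"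
    by blast
  have sym: "E v u" if "E u v" for u v
    using that pair_sym_arcs by (auto simp: E_def symmetric_def elim: symE)
  have irrefl: "\<not> E v v" for v
    using pair_no_loops[of "(v, v)"] by (auto simp: E_def)
  have "card {u \<in> pverts G. f u < f v \<and> E v u} \<le> d \<or>
      card {u \<in> pverts G. f u < f v \<and> \<not> E v u} \<le> d" if "v \<in> pverts G" for v
  proof -
    \<comment> \<open>Injectivity makes \<open>f u \<le> f v\<close> strict for \<open>u \<noteq> v\<close>.\<close>
    have below: "f u < f v \<longleftrightarrow> f u \<le> f v \<and> u \<noteq> v" if "u \<in> pverts G" for u
      using f(1) that \<open>v \<in> pverts G\<close> by (auto simp: order.order_iff_strict dest: inj_onD)
    have "{u \<in> {u \<in> pverts G. f u \<le> f v}. E v u} = {u \<in> pverts G. f u < f v \<and> E v u}"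
      using irrefl below by blast
    moreover have "{u \<in> {u \<in> pverts G. f u \<le> f v}. u \<noteq> v \<and> \<not> E v u} =
        {u \<in> pverts G. f u < f v \<and> \<not> E v u}"
      using below by blast
    ultimately show ?thesis
      using f(3)[OF that] unfolding few_def by simp
  qed
  then show "\<exists>lab. lab ` pverts G \<subseteq> labels d (card (pverts G)) \<and>
      (\<forall>u\<in>pverts G. \<forall>v\<in>pverts G. (u, v) \<in> parcs G \<longleftrightarrow> label_adj (lab u) (lab v))"
    using ordered_labelling[of "pverts G" f _ E d, OF pair_finite_verts f(1,2) sym irrefl]
    by (simp add: E_def)
qed simp

end
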